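(* For any fixed integer $d\geq 3$ and for all integers $n\geq 2$, there is a set of $n$ points in general position in $\mathbb{R}^d$ that admits at most $O\big((d+d\ln d)^{(2+\frac{d-1}{\lfloor d\ln d\rfloor})n}\big)$ peeling sequences. In other words, $$g_d(n)\leq O\Big((d+d\ln d)^{\left(2+\frac{d-1}{\lfloor d\ln d\rfloor}\right)n}\Big).$$
   Context: A finite set $P$ of (distinct, labelled) points in $\mathbb{R}^d$ is in general position if no $d+1$ of its points lie on the same hyperplane. A peeling sequence of $P$ is the sequence of labels obtained by the following process: in each step remove exactly one vertex of the convex hull of the current remaining point set and write down its label; repeat until all points of $P$ have been removed. For $P$ in general position in $\mathbb{R}^d$, $g_d(P)$ denotes the number of different peeling sequences of $P$, and $g_d(n)=\min_{|P|=n} g_d(P)$, where the minimum is taken over all $n$-element point sets $P$ in general position in $\mathbb{R}^d$. The $O$-notation is for fixed $d$: $g_d(n)\le O(f(n))$ means that there is a constant $C>0$ with $g_d(n)\le C f(n)$ for all $n\ge 2$. Here $\ln$ is the natural logarithm. *)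

theory Defs
  imports "HOL-Analysis.Analysis"
begin

definition general_position :: "'a::euclidean_space set \<Rightarrow> bool" where
  "general_position P \<longleftrightarrow>
     (\<forall>S. S \<subseteq> P \<longrightarrow> card S = DIM('a) + 1 \<longrightarrow>
        \<not> (\<exists>a b. a \<noteq> 0 \<and> S \<subseteq> {x. a \<bullet> x = b}))"

text \<open>Distinct points carry distinct labels, so each point serves as its own label.\<close>

inductive peeling_sequence :: "'a::euclidean_space set \<Rightarrow> 'a list \<Rightarrow> bool" where
  Nil: "peeling_sequence {} []"
| Cons: "p extreme_point_of (convex hull P) \<Longrightarrow> peeling_sequence (P - {p}) ps
           \<Longrightarrow> peeling_sequence P (p # ps)"

lemma peeling_sequence_distinct_set:
  assumes "peeling_sequence P ps"
  shows "distinct ps \<and> set ps = P"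
  using assms
proof induction
  case Nil
  show ?case by simp
next
  case (Cons p P ps)
  from Cons.hyps(1) have "p \<in> P" by (rule extreme_point_of_convex_hull)
  with Cons.IH show ?case by auto
qed

text \<open>This finiteness ensures that \<open>card\<close> below is a genuine count.\<close>

lemma finite_peeling_sequences:
  assumes "finite P"
  shows "finite {ps. peeling_sequence P ps}"
proof (rule finite_subset)
  show "{ps. peeling_sequence P ps} \<subseteq> {ps. set ps \<subseteq> P \<and> distinct ps}"
    using peeling_sequence_distinct_set by blast
  show "finite {ps. set ps \<subseteq> P \<and> distinct ps}"
    using assms by (rule finite_subset_distinct)
qed

definition num_peelings :: "'a::euclidean_space set \<Rightarrow> nat" where
  "num_peelings P = card {ps. peeling_sequence P ps}"

text \<open>The minimum over all \<open>n\<close>-point sets in general position.  The dimension is that of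
  the type argument.  The infimum of a nonempty set of naturals is its minimum; of the empty
  set it is \<open>0\<close>, so an upper bound on it is informative only alongside the existence of an
  \<open>n\<close>-point set in general position.\<close>

definition min_peelings :: "'a::euclidean_space itself \<Rightarrow> nat \<Rightarrow> nat" where
  "min_peelings _ n =
     (INF P \<in> {P :: 'a set. finite P \<and> card P = n \<and> general_position P}. num_peelings P)"

end

theory Submission
  imports Defs
begin

text \<open>
  The point set is a star with \<open>m = d + 2 * k - 1\<close> arms, \<open>k = \<lfloor>d * ln d\<rfloor>\<close>, placed along rays from the
  origin, and each arm is a copy of a smaller set of the same kind, flattened by an affine map until
  it nearly lies on its ray. The rays are chosen so that every open half-space contains at least \<open>k\<close> of
  them (lemma \<open>rays_meeting_every_halfspace\<close>, by the alternating moment curve). So while fewer than \<open>k\<close>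
  arms have been used up, the remaining rays surround the origin, every point that is not the
  outermost of its arm is interior to the hull, and a peeling step merely chooses an arm. Once \<open>k\<close> arms
  are used up, at most \<open>c = d + k - 1\<close> arms are left, and a peeling sequence of the rest is a shuffle of
  peeling sequences of these arms, to which induction applies (lemmas \<open>star_of_copies\<close> and
  \<open>num_orders_star\<close>).

  For the count, let \<open>\<gamma> = c powr (c / k)\<close>. The recursion yields that a subset \<open>Q\<close> of the first \<open>N\<close> points
  of the construction has at most \<open>E * (k + 1) ^ card Q * \<gamma> ^ N\<close> peeling sequences. Here \<open>\<gamma> ^ k = c ^ c\<close>
  says that the \<open>k\<close> vanished arms, which no longer contribute to the recursion, pay for shuffling the \<open>c\<close>
  surviving ones. The factor \<open>E\<close> depends on the depth of the recursion only and is subexponential in \<open>N\<close>,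
  because just \<open>c\<close> of the \<open>m\<close> arms pass it on. For \<open>Q\<close> the whole set the growth rate is
  \<open>(k + 1) * (d + k - 1) powr (1 + (d - 1) / k)\<close>, which is strictly below
  \<open>(d + d * ln d) powr (2 + (d - 1) / k)\<close>; the gap absorbs \<open>E\<close>.

  General position never constrains the construction. The counts refer to points that are not
  surrounded by the others, a condition weaker than being a vertex of the hull and stable in the right
  direction: a small perturbation does not create new removable points (lemma \<open>removable_stable\<close>). Hence a
  final perturbation (lemma \<open>general_position_perturbation\<close>) gives general position without increasing the
  bound.
\<close>

section \<open>Directions with many members in every open half-space\<close>

text \<open>The left-hand side is, up to sign, the \<open>n\<close>-th finite difference of \<open>p\<close> at \<open>0\<close>. The induction
strips off the constant coefficient and absorbs the remaining factor \<open>i\<close> into the binomial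
coefficient by \<open>(i+1) * (n+1 choose i+1) = (n+1) * (n choose i)\<close>.\<close>

lemma alternating_binomial_sum_poly:
  fixes p :: "real poly"
  assumes "degree p < n"
  shows "(\<Sum>i\<le>n. (-1) ^ i * real (n choose i) * poly p (real i)) = 0"
  using assms
proof (induction n arbitrary: p)
  case 0
  then show ?case by simp
next
  case (Suc n)
  obtain a q where p: "p = pCons a q" by (cases p)
  define q' where "q' = q \<circ>\<^sub>p [:1, 1:]"
  have q': "poly q' (real i) = poly q (real (Suc i))" for i
    by (simp add: q'_def poly_pcompose algebra_simps)
  have const: "(\<Sum>i\<le>Suc n. (-1) ^ i * real (Suc n choose i)) = 0"
    using choose_alternating_sum[of "Suc n", where ?'a = real] by simp
  have shift: "(\<Sum>i\<le>Suc n. (-1) ^ i * real (Suc n choose i) * (real i * poly q (real i)))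
      = - real (Suc n) * (\<Sum>i\<le>n. (-1) ^ i * real (n choose i) * poly q' (real i))"
  proof -
    have term': "(-1) ^ Suc i * real (Suc n choose Suc i) * (real (Suc i) * poly q (real (Suc i)))
       = - real (Suc n) * ((-1) ^ i * real (n choose i) * poly q' (real i))" for i
    proof -
      have "real (Suc i) * real (Suc n choose Suc i) = real (Suc n) * real (n choose i)"
        by (metis Suc_times_binomial of_nat_mult)
      then have "(-1) ^ Suc i * poly q' (real i) * (real (Suc i) * real (Suc n choose Suc i))
          = (-1) ^ Suc i * poly q' (real i) * (real (Suc n) * real (n choose i))"
        by simp
      then show ?thesis unfolding q'[symmetric] by (simp only: power_Suc mult_ac mult_minus_left mult_1_left)
    qed
    show ?thesis
      unfolding sum.atMost_Suc_shift term' sum_distrib_left by simp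
  qed
  have zero: "(\<Sum>i\<le>n. (-1) ^ i * real (n choose i) * poly q' (real i)) = 0"
  proof (cases "q = 0")
    case True
    then show ?thesis by (simp add: q'_def)
  next
    case False
    then have "degree q' < n"
      using Suc.prems p by (simp add: q'_def degree_pcompose)
    then show ?thesis by (rule Suc.IH)
  qed
  have "(\<Sum>i\<le>Suc n. (-1) ^ i * real (Suc n choose i) * poly p (real i))
      = a * (\<Sum>i\<le>Suc n. (-1) ^ i * real (Suc n choose i))
        + (\<Sum>i\<le>Suc n. (-1) ^ i * real (Suc n choose i) * (real i * poly q (real i)))"
    unfolding sum_distrib_left sum.distrib[symmetric] p
    by (intro sum.cong) (auto simp: algebra_simps)
  also have "\<dots> = 0"
    unfolding const shift zero by simp
  finally show ?case .
qed

text \<open>If the set \<open>G\<close> of good indices had fewer than \<open>j\<close> elements, a polynomial \<open>q\<close> of degree at most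
\<open>2 * (j - 1)\<close> could flip the sign of \<open>p\<close> exactly on \<open>G\<close>. Then \<open>p * q\<close> would alternate weakly in
sign on \<open>0, \<dots>, m - 1\<close> while its degree is below \<open>m - 1\<close>; the vanishing \<open>(m-1)\<close>-st difference forces
it to vanish at all these \<open>m\<close> integers, so \<open>p * q = 0\<close>.\<close>

lemma alternating_poly_positive_often:
  fixes p :: "real poly"
  assumes "p \<noteq> 0" "degree p < d"
  shows "j \<le> card {i. i < d + 2 * j - 1 \<and> 0 < (-1) ^ i * poly p (real i)}"
proof (rule ccontr)
  define m where "m = d + 2 * j - 1"
  define G where "G = {i. i < m \<and> 0 < (-1) ^ i * poly p (real i)}"
  assume "\<not> ?thesis"
  then have less: "card G < j" by (simp add: G_def m_def)
  have finG: "finite G" by (simp add: G_def)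
  \<comment> \<open>The factor of \<open>g\<close> is \<open>(x - g)\<^sup>2 - 1/4\<close>: among the integers it is negative at \<open>g\<close> only.\<close>
  define q where "q = (\<Prod>g\<in>G. [:(real g)\<^sup>2 - 1/4, - 2 * real g, 1:])"
  have q_eval: "poly q (real i) = (\<Prod>g\<in>G. (real i - real g)\<^sup>2 - 1/4)" for i
    by (simp add: q_def poly_prod power2_eq_square algebra_simps)
  have apart: "(real i - real g)\<^sup>2 - 1/4 > 0" if "i \<noteq> g" for i g :: nat
  proof -
    have "1 \<le> \<bar>real i - real g\<bar>" using that by linarith
    then have "1\<^sup>2 \<le> \<bar>real i - real g\<bar>\<^sup>2" by (intro power_mono) auto
    then show ?thesis by simp
  qed
  have q_pos: "poly q (real i) > 0" if "i \<notin> G" for i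
    unfolding q_eval using that by (intro prod_pos apart) auto
  have q_neg: "poly q (real i) < 0" if "i \<in> G" for i
  proof -
    have "0 < (\<Prod>g\<in>G - {i}. (real i - real g)\<^sup>2 - 1/4)"
      by (intro prod_pos apart) auto
    then show ?thesis
      unfolding q_eval prod.remove[OF finG that] by simp
  qed
  define r where "r = p * q"
  have "degree q \<le> (\<Sum>g\<in>G. 2)"
    unfolding q_def by (rule order.trans[OF degree_prod_sum_le[OF finG]]) (simp add: o_def)
  then have deg_r: "degree r < m - 1"
    using degree_mult_le[of p q] assms(2) less by (simp add: r_def m_def)
  have sum0: "(\<Sum>i\<le>m - 1. (-1) ^ i * real (m - 1 choose i) * poly r (real i)) = 0"
    using deg_r by (rule alternating_binomial_sum_poly)
  have sign: "(-1) ^ i * real (m - 1 choose i) * poly r (real i) \<le> 0" if "i \<le> m - 1" for i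
  proof -
    have "i < m" using that deg_r by simp
    have "(-1) ^ i * poly p (real i) * poly q (real i) \<le> 0"
    proof (cases "i \<in> G")
      case True
      then show ?thesis using q_neg[OF True] by (simp add: G_def mult_pos_neg less_imp_le)
    next
      case False
      then show ?thesis using q_pos[OF False] \<open>i < m\<close>
        by (intro mult_nonpos_nonneg[of "(-1) ^ i * poly p (real i)"]) (auto simp: G_def)
    qed
    then have "real (m - 1 choose i) * ((-1) ^ i * poly p (real i) * poly q (real i)) \<le> 0"
      by (rule mult_nonneg_nonpos[OF of_nat_0_le_iff])
    then show ?thesis by (simp add: r_def mult_ac)
  qed
  have "poly r (real i) = 0" if "i \<le> m - 1" for i
  proof -
    have "\<forall>i\<in>{..m-1}. - ((-1) ^ i * real (m - 1 choose i) * poly r (real i)) = 0"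
      by (subst sum_nonneg_eq_0_iff[symmetric]) (use sign sum0 in \<open>auto simp: sum_negf\<close>)
    then show ?thesis using that by auto
  qed
  then have sub: "real ` {..m - 1} \<subseteq> {x. poly r x = 0}" by auto
  have "q \<noteq> 0" unfolding q_def using finG by simp
  then have "r \<noteq> 0" using assms(1) by (simp add: r_def)
  then have "card (real ` {..m - 1}) \<le> degree r"
    using card_mono[OF poly_roots_finite sub] card_poly_roots_bound[of r] by fastforce
  moreover have "card (real ` {..m - 1}) = m - 1 + 1"
    by (subst card_image) auto
  ultimately show False using deg_r by simp
qed

text \<open>After the removal of any \<open>j - 1\<close> of these \<open>d + 2 * j - 1\<close> vectors the rest still surrounds the
origin; Gale observed that fewer vectors cannot do this. They lie on the moment curve with alternating signs, so that \<open>a \<bullet> v i\<close> is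
\<open>(-1) ^ i\<close> times the value at \<open>i\<close> of the polynomial with coefficient vector \<open>a\<close>.\<close>

lemma rays_meeting_every_halfspace:
  obtains v :: "nat \<Rightarrow> real ^ 'd::finite"
  where "\<And>a. a \<noteq> 0 \<Longrightarrow> j \<le> card {i. i < CARD('d) + 2 * j - 1 \<and> 0 < a \<bullet> v i}"
proof -
  obtain f :: "'d \<Rightarrow> nat" where f: "bij_betw f UNIV {0..<CARD('d)}"
    using ex_bij_betw_finite_nat[of "UNIV :: 'd set"] by auto
  define v :: "nat \<Rightarrow> real ^ 'd" where "v i = (\<chi> l. (-1) ^ i * real i ^ f l)" for i
  have "j \<le> card {i. i < CARD('d) + 2 * j - 1 \<and> 0 < a \<bullet> v i}" if "a \<noteq> 0" for a
  proof -
    define p where "p = (\<Sum>l\<in>UNIV. monom (a $ l) (f l))"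
    have inj: "f k = f l \<longleftrightarrow> k = l" for k l
      using f by (metis UNIV_I bij_betw_def inj_onD)
    have "coeff p (f l) = a $ l" for l
      by (simp add: p_def coeff_sum inj if_distrib cong: if_cong)
    then have "p \<noteq> 0" using that by (metis coeff_0 vec_eq_iff zero_index)
    have "f l < CARD('d)" for l using f by (auto simp: bij_betw_def)
    then have "degree p < CARD('d)" unfolding p_def
      by (intro degree_sum_less) (auto intro: le_less_trans[OF degree_monom_le])
    have "a \<bullet> v i = (-1) ^ i * poly p (real i)" for i
      by (simp add: inner_vec_def v_def p_def poly_sum poly_monom sum_distrib_left algebra_simps)
    then show ?thesis
      using alternating_poly_positive_often[OF \<open>p \<noteq> 0\<close> \<open>degree p < _\<close>] by simp
  qed
  then show thesis by (rule that)
qed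

section \<open>Surrounded points\<close>

text \<open>For finite \<open>T\<close> this says that \<open>x\<close> lies in the interior of the convex hull of the points \<open>y t\<close>.
The formulation by linear functionals makes the behaviour under linear maps and under perturbation
immediate.\<close>

definition surrounds :: "'i set \<Rightarrow> ('i \<Rightarrow> 'a::euclidean_space) \<Rightarrow> 'a \<Rightarrow> bool" where
  "surrounds T y x \<longleftrightarrow> (\<forall>a. a \<noteq> 0 \<longrightarrow> (\<exists>t\<in>T. 0 < a \<bullet> (y t - x)))"

text \<open>A relaxation of being a vertex of the hull. Unlike extremality it can only be lost, never gained,
under a small perturbation, so that general position may be restored at any time without increasing
the number of removal orders.\<close>

definition removable :: "('i \<Rightarrow> 'a::euclidean_space) \<Rightarrow> 'i set \<Rightarrow> 'i \<Rightarrow> bool" where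
  "removable p Q t \<longleftrightarrow> \<not> surrounds (Q - {t}) p (p t)"

lemma surrounds_in_convex_hull:
  fixes x :: "'a::euclidean_space"
  assumes "finite T" "surrounds T y x"
  shows "x \<in> convex hull (y ` T)"
proof (rule ccontr)
  assume "x \<notin> convex hull (y ` T)"
  moreover have "closed (convex hull (y ` T))"
    using assms(1) by (intro compact_imp_closed finite_imp_compact_convex_hull) simp
  ultimately obtain a b where ab: "a \<bullet> x < b" "\<forall>z\<in>convex hull (y ` T). a \<bullet> z > b"
    using separating_hyperplane_closed_point[OF convex_convex_hull] by metis
  obtain u :: 'a where "u \<noteq> 0" using nonzero_Basis nonempty_Basis by blast
  then obtain t0 where t0: "t0 \<in> T" using assms(2) unfolding surrounds_def by blast
  have below: "(- a) \<bullet> (y t - x) < 0" if "t \<in> T" for t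
  proof -
    have "y t \<in> convex hull (y ` T)" using that by (simp add: hull_inc)
    then show ?thesis using ab by (fastforce simp: inner_diff_right)
  qed
  have "a \<noteq> 0" using below[OF t0] by auto
  then obtain t where "t \<in> T" "0 < (- a) \<bullet> (y t - x)"
    using assms(2) unfolding surrounds_def by (metis neg_equal_0_iff_equal)
  then show False using below by force
qed

lemma extreme_imp_removable:
  assumes "finite Q" "inj_on p Q" "t \<in> Q" "p t extreme_point_of (convex hull (p ` Q))"
  shows "removable p Q t"
  unfolding removable_def
proof
  assume "surrounds (Q - {t}) p (p t)"
  then have "p t \<in> convex hull (p ` (Q - {t}))"
    using assms(1) by (intro surrounds_in_convex_hull) auto
  moreover have "p ` (Q - {t}) = p ` Q - {p t}"
    using assms(2,3) by (auto simp: inj_on_def)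
  ultimately have "p t \<in> convex hull (p ` Q - {p t})" by simp
  moreover have "convex (convex hull (p ` Q) - {p t})"
    using assms(4) extreme_point_of_stillconvex[OF convex_convex_hull] by blast
  then have "convex hull (p ` Q - {p t}) \<subseteq> convex hull (p ` Q) - {p t}"
    by (intro hull_minimal) (auto simp: hull_inc)
  ultimately show False by blast
qed

text \<open>The sum \<open>f a\<close> of the positive parts of \<open>a \<bullet> (y t - x)\<close> is continuous and positive on the unit
sphere, hence bounded away from zero there. So every unit vector \<open>a\<close> has some \<open>t\<close> for which
\<open>a \<bullet> (y t - x)\<close> exceeds a fixed constant.\<close>

lemma surrounds_stable:
  fixes y :: "'i \<Rightarrow> 'a::euclidean_space"
  assumes "finite T" "surrounds T y x"
  obtains \<delta> where "0 < \<delta>"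
    "\<And>y' x'. dist x' x < \<delta> \<Longrightarrow> (\<And>t. t \<in> T \<Longrightarrow> dist (y' t) (y t) < \<delta>) \<Longrightarrow> surrounds T y' x'"
proof -
  define f where "f a = (\<Sum>t\<in>T. max 0 (a \<bullet> (y t - x)))" for a
  have ne: "sphere (0::'a) 1 \<noteq> {}" using nonempty_Basis by (auto simp: norm_Basis)
  have "continuous_on (sphere 0 1) f"
    unfolding f_def by (intro continuous_intros)
  then obtain b where b: "b \<in> sphere 0 1" "\<And>a. a \<in> sphere 0 1 \<Longrightarrow> f b \<le> f a"
    using continuous_attains_inf[OF compact_sphere ne] by metis
  have "b \<noteq> 0" using b(1) by auto
  then obtain t0 where t0: "t0 \<in> T" "0 < b \<bullet> (y t0 - x)"
    using assms(2) unfolding surrounds_def by blast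
  have "max 0 (b \<bullet> (y t0 - x)) \<le> f b"
    unfolding f_def using t0 assms(1) by (intro member_le_sum) auto
  then have fb: "0 < f b" using t0 by linarith
  define \<delta> where "\<delta> = f b / (4 * real (card T))"
  have cT: "0 < real (card T)" using t0 assms(1) by (auto simp: card_gt_0_iff)
  show thesis
  proof (rule that)
    show "0 < \<delta>" unfolding \<delta>_def using fb cT by simp
  next
    fix y' x' assume x': "dist x' x < \<delta>" and y': "\<And>t. t \<in> T \<Longrightarrow> dist (y' t) (y t) < \<delta>"
    show "surrounds T y' x'" unfolding surrounds_def
    proof (intro allI impI)
      fix a :: 'a assume "a \<noteq> 0"
      define u where "u = a /\<^sub>R norm a"
      have nu: "norm u = 1" using \<open>a \<noteq> 0\<close> by (simp add: u_def)
      then have "f b \<le> f u" by (intro b) simp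
      have "\<exists>t\<in>T. 2 * \<delta> < u \<bullet> (y t - x)"
      proof (rule ccontr)
        assume "\<not> ?thesis"
        then have "max 0 (u \<bullet> (y t - x)) \<le> 2 * \<delta>" if "t \<in> T" for t
          using that fb cT by (auto simp: \<delta>_def not_less)
        then have "f u \<le> real (card T) * (2 * \<delta>)" unfolding f_def by (rule sum_bounded_above)
        also have "\<dots> < f b" using fb cT by (simp add: \<delta>_def field_simps)
        finally show False using \<open>f b \<le> f u\<close> by simp
      qed
      then obtain t where t: "t \<in> T" "2 * \<delta> < u \<bullet> (y t - x)" by blast
      have "\<bar>u \<bullet> (y' t - y t)\<bar> < \<delta>"
        using Cauchy_Schwarz_ineq2[of u "y' t - y t"] nu y'[OF t(1)] by (simp add: dist_norm)
      moreover have "\<bar>u \<bullet> (x' - x)\<bar> < \<delta>"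
        using Cauchy_Schwarz_ineq2[of u "x' - x"] nu x' by (simp add: dist_norm)
      ultimately have "0 < u \<bullet> (y' t - x')" using t(2) by (simp add: inner_diff_right)
      then have "0 < a \<bullet> (y' t - x')"
        using \<open>a \<noteq> 0\<close> by (simp add: u_def zero_less_mult_iff)
      then show "\<exists>t\<in>T. 0 < a \<bullet> (y' t - x')" using t(1) by blast
    qed
  qed
qed

lemma removable_stable:
  fixes p :: "'i \<Rightarrow> 'a::euclidean_space"
  assumes "finite A"
  obtains \<delta> where "0 < \<delta>"
    "\<And>p' Q t. (\<And>s. s \<in> A \<Longrightarrow> dist (p' s) (p s) < \<delta>) \<Longrightarrow> Q \<subseteq> A \<Longrightarrow> t \<in> Q \<Longrightarrow>
       removable p' Q t \<Longrightarrow> removable p Q t"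
proof -
  define X where "X = {(Q, t). Q \<subseteq> A \<and> t \<in> Q \<and> surrounds (Q - {t}) p (p t)}"
  have "X \<subseteq> Pow A \<times> A" by (auto simp: X_def)
  then have finX: "finite X" using assms by (meson finite_Pow_iff finite_SigmaI finite_subset)
  have "\<exists>\<delta>>0. \<forall>p'. (\<forall>s\<in>A. dist (p' s) (p s) < \<delta>) \<longrightarrow> surrounds (fst z - {snd z}) p' (p' (snd z))"
    if "z \<in> X" for z
  proof -
    obtain Q t where z: "z = (Q, t)" by fastforce
    have Qt: "Q \<subseteq> A" "t \<in> Q" "surrounds (Q - {t}) p (p t)" using that z by (auto simp: X_def)
    have "finite (Q - {t})" using Qt(1) assms finite_subset by blast
    from surrounds_stable[OF this Qt(3)] obtain \<delta> where "0 < \<delta>" and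
      \<delta>: "\<And>y' x'. dist x' (p t) < \<delta> \<Longrightarrow> (\<And>s. s \<in> Q - {t} \<Longrightarrow> dist (y' s) (p s) < \<delta>) \<Longrightarrow> surrounds (Q - {t}) y' x'"
      by blast
    show ?thesis using \<open>0 < \<delta>\<close> \<delta> Qt(1,2) z by (intro exI[of _ \<delta>]) auto
  qed
  then obtain d where d: "\<And>z. z \<in> X \<Longrightarrow> 0 < d z"
    "\<And>z p'. z \<in> X \<Longrightarrow> (\<forall>s\<in>A. dist (p' s) (p s) < d z) \<Longrightarrow> surrounds (fst z - {snd z}) p' (p' (snd z))"
    by metis
  define \<delta> where "\<delta> = Min (insert 1 (d ` X))"
  have "0 < \<delta>" unfolding \<delta>_def using finX d(1) by (subst Min_gr_iff) auto
  have le: "\<delta> \<le> d z" if "z \<in> X" for z unfolding \<delta>_def using finX that by (intro Min_le) auto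
  show thesis
  proof (rule that[OF \<open>0 < \<delta>\<close>], rule ccontr)
    fix p' Q t assume close: "\<And>s. s \<in> A \<Longrightarrow> dist (p' s) (p s) < \<delta>"
      and Qt: "Q \<subseteq> A" "t \<in> Q" and r: "removable p' Q t" "\<not> removable p Q t"
    then have X: "(Q, t) \<in> X" by (simp add: X_def removable_def)
    then have "surrounds (Q - {t}) p' (p' t)"
      using d(2)[OF X, of p'] close le[OF X] by fastforce
    then show False using r(1) by (simp add: removable_def)
  qed
qed

section \<open>Perturbation into general position\<close>

lemma general_position_if_affine_independent:
  fixes P :: "'a::euclidean_space set"
  assumes "\<And>S. S \<subseteq> P \<Longrightarrow> card S \<le> DIM('a) + 1 \<Longrightarrow> \<not> affine_dependent S"
  shows "general_position P"
  unfolding general_position_def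
proof (intro allI impI notI)
  fix S assume S: "S \<subseteq> P" "card S = DIM('a) + 1" and "\<exists>a b. a \<noteq> 0 \<and> S \<subseteq> {x. a \<bullet> x = b}"
  then obtain a b where a: "a \<noteq> 0" "S \<subseteq> {x. a \<bullet> x = b}" by blast
  have "aff_dim S = int DIM('a)"
    using assms(1)[OF S(1)] S(2) aff_dim_affine_independent[of S] by simp
  moreover have "aff_dim S \<le> aff_dim {x. a \<bullet> x = b}" using a(2) by (rule aff_dim_subset)
  ultimately show False using a(1) by (simp add: aff_dim_hyperplane)
qed

lemma negligible_affine_hull:
  fixes S :: "'a::euclidean_space set"
  assumes "finite S" "card S \<le> DIM('a)"
  shows "negligible (affine hull S)"
  using empty_interior_affine_hull[OF assms]
  by (simp add: negligible_convex_interior affine_imp_convex)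

text \<open>The points are moved one after another, each avoiding the affine hulls of all sets of at most
\<open>d\<close> earlier points, which have measure zero. The invariant is affine independence of all subsets of
at most \<open>d + 1\<close> points rather than general position itself: in a general position set of at most \<open>d\<close>
points a subset may still be affinely dependent, and then no later point could avoid all hyperplanes
through it.\<close>

lemma general_position_perturbation:
  fixes q :: "nat \<Rightarrow> 'a::euclidean_space"
  assumes "0 < \<delta>"
  shows "\<exists>p. (\<forall>t<N. dist (p t) (q t) < \<delta>) \<and> inj_on p {..<N} \<and> general_position (p ` {..<N})"
proof -
  have "\<exists>p. (\<forall>t<N. dist (p t) (q t) < \<delta>) \<and> inj_on p {..<N} \<and>
      (\<forall>S. S \<subseteq> p ` {..<N} \<longrightarrow> card S \<le> DIM('a) + 1 \<longrightarrow> \<not> affine_dependent S)"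
  proof (induction N)
    case 0
    then show ?case by (auto simp: affine_dependent_def)
  next
    case (Suc N)
    then obtain p where p: "\<forall>t<N. dist (p t) (q t) < \<delta>" "inj_on p {..<N}"
      "\<And>S. S \<subseteq> p ` {..<N} \<Longrightarrow> card S \<le> DIM('a) + 1 \<Longrightarrow> \<not> affine_dependent S" by blast
    define H where "H = p ` {..<N} \<union> (\<Union>S\<in>{S. S \<subseteq> p ` {..<N} \<and> card S \<le> DIM('a)}. affine hull S)"
    have "negligible H" unfolding H_def
    proof (intro negligible_Un negligible_Union)
      show "negligible (p ` {..<N})" by (simp add: negligible_finite)
      show "finite ((hull) affine ` {S. S \<subseteq> p ` {..<N} \<and> card S \<le> DIM('a)})" by simp
      fix t assume "t \<in> (hull) affine ` {S. S \<subseteq> p ` {..<N} \<and> card S \<le> DIM('a)}"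
      then show "negligible t" by (auto intro!: negligible_affine_hull dest: finite_subset)
    qed
    moreover have "\<not> negligible (ball (q N) \<delta>)"
      using assms by (intro open_not_negligible) auto
    ultimately obtain x where x: "x \<in> ball (q N) \<delta>" "x \<notin> H"
      by (meson negligible_subset subsetI)
    define p' where "p' = p(N := x)"
    have img: "p' ` {..<N} = p ` {..<N}" by (auto simp: p'_def)
    have img': "p' ` {..<Suc N} = insert x (p ` {..<N})"
      unfolding lessThan_Suc image_insert img by (simp add: p'_def)
    have xn: "x \<notin> p ` {..<N}" using x(2) by (auto simp: H_def)
    have "inj_on p' {..<Suc N}"
      using p(2) xn by (auto simp: lessThan_Suc p'_def inj_on_def)
    moreover have "\<forall>t<Suc N. dist (p' t) (q t) < \<delta>"
      using p(1) x(1) by (auto simp: p'_def less_Suc_eq dist_commute)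
    moreover have "\<not> affine_dependent S" if S: "S \<subseteq> p' ` {..<Suc N}" "card S \<le> DIM('a) + 1" for S
    proof (cases "x \<in> S")
      case False
      then show ?thesis using S p(3) by (auto simp: img')
    next
      case True
      have fin: "finite S" using S(1) finite_subset by blast
      have sub: "S - {x} \<subseteq> p ` {..<N}" using S(1) by (auto simp: img')
      have c: "card (S - {x}) \<le> DIM('a)" using S(2) True fin by simp
      have "\<not> affine_dependent (S - {x})" using p(3)[OF sub] c by simp
      moreover have "x \<notin> affine hull (S - {x})" using x(2) sub c unfolding H_def by blast
      ultimately show ?thesis using affine_independent_insert True by (metis insert_Diff)
    qed
    ultimately show ?case by blast
  qed
  then show ?thesis using general_position_if_affine_independent by metis
qed

lemma separating_functional:
  fixes q :: "nat \<Rightarrow> 'a::euclidean_space"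
  assumes "inj_on q {..<M}"
  obtains w where "inj_on (\<lambda>s. w \<bullet> q s) {..<M}"
proof -
  define H where "H = (\<Union>(s, t)\<in>{(s, t). s < M \<and> t < M \<and> s \<noteq> t}. {w. (q s - q t) \<bullet> w = 0})"
  have "finite {(s, t). s < M \<and> t < M \<and> s \<noteq> t}"
    by (rule finite_subset[of _ "{..<M} \<times> {..<M}"]) auto
  then have "negligible H" unfolding H_def using assms
    by (intro negligible_Union) (auto intro!: negligible_hyperplane simp: inj_on_def)
  then have "H \<noteq> UNIV" by auto
  then obtain w where "w \<notin> H" by blast
  then have "inj_on (\<lambda>s. w \<bullet> q s) {..<M}"
    by (auto simp: H_def inj_on_def inner_diff_left inner_commute[of _ w])
  then show thesis by (rule that)
qed

section \<open>A star of flattened copies\<close>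

text \<open>Index \<open>t\<close> stands for the member \<open>t div m\<close> of arm \<open>t mod m\<close>. With this numbering every initial
segment of the indices is spread evenly over the arms, and all arms can share a single sequence of
points.\<close>

definition arm :: "nat \<Rightarrow> nat set \<Rightarrow> nat \<Rightarrow> nat set" where
  "arm m Q i = {s. s * m + i \<in> Q}"

text \<open>Copy \<open>i\<close> is flattened onto the ray through \<open>v i\<close> by the affine map
\<open>x \<mapsto> (w \<bullet> x + K) *\<^sub>R v i + \<epsilon> *\<^sub>R x\<close>. For all but finitely many \<open>\<epsilon>\<close> this map is injective, so each
single arm is an affine copy of \<open>q\<close> and inherits its surrounded points; this is the first claim. For
\<open>\<epsilon> = 0\<close> the points lie on the rays. If more than \<open>m - j\<close> arms are present, every open half-space
bounded by a hyperplane through the origin contains a point of a present arm; hence a point that has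
another point of its own arm farther out is surrounded, and only the tips of the arms are removable.
By stability this persists for small \<open>\<epsilon> > 0\<close>, which is the second claim.\<close>

lemma star_of_copies:
  fixes q v :: "nat \<Rightarrow> 'a::euclidean_space"
  assumes "0 < m" and "inj_on q {..<M}"
    and rays: "\<And>a. a \<noteq> 0 \<Longrightarrow> j \<le> card {i. i < m \<and> 0 < a \<bullet> v i}"
  obtains p :: "nat \<Rightarrow> 'a" where
    "\<And>Q t. Q \<subseteq> {..<m * M} \<Longrightarrow> t \<in> Q \<Longrightarrow> removable p Q t \<Longrightarrow> removable q (arm m Q (t mod m)) (t div m)"
    "\<And>Q. Q \<subseteq> {..<m * M} \<Longrightarrow> m < j + card {i. i < m \<and> arm m Q i \<noteq> {}} \<Longrightarrow>
       inj_on (\<lambda>t. t mod m) {t \<in> Q. removable p Q t}"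
proof -
  obtain w where w: "inj_on (\<lambda>s. w \<bullet> q s) {..<M}" using separating_functional[OF assms(2)] .
  \<comment> \<open>The shift \<open>K\<close> puts the whole flattened copy on the positive side of its ray.\<close>
  define K where "K = (\<Sum>s<M. \<bar>w \<bullet> q s\<bar>) + 1"
  define h where "h s = w \<bullet> q s + K" for s
  have hpos: "0 < h s" if "s < M" for s
  proof -
    have "\<bar>w \<bullet> q s\<bar> \<le> (\<Sum>s<M. \<bar>w \<bullet> q s\<bar>)" using that by (intro member_le_sum) auto
    then show ?thesis by (simp add: h_def K_def)
  qed
  have hinj: "s = s'" if "s < M" "s' < M" "h s = h s'" for s s'
    using w that by (auto simp: h_def inj_on_def)
  \<comment> \<open>The limit configuration for \<open>\<epsilon> = 0\<close>.\<close>
  define y where "y t = h (t div m) *\<^sub>R v (t mod m)" for t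
  have div_less: "t div m < M" if "t < m * M" for t
    using that by (simp add: less_mult_imp_div_less mult.commute)
  have inner_hidden: "\<not> removable y Q t"
    if Q: "Q \<subseteq> {..<m * M}" and I: "m < j + card {i. i < m \<and> arm m Q i \<noteq> {}}"
      and t: "t \<in> Q" "t' \<in> Q" "t mod m = t' mod m" "h (t div m) < h (t' div m)" for Q t t'
    unfolding removable_def surrounds_def not_not
  proof (intro allI impI)
    fix a :: 'a assume "a \<noteq> 0"
    have t0: "0 < h (t div m)" using Q t(1) by (intro hpos div_less) auto
    show "\<exists>t''\<in>Q - {t}. 0 < a \<bullet> (y t'' - y t)"
    proof (cases "0 < a \<bullet> v (t mod m)")
      case True
      have "a \<bullet> (y t' - y t) = (h (t' div m) - h (t div m)) * (a \<bullet> v (t mod m))"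
        using t(3) by (simp add: y_def inner_diff_right algebra_simps)
      also have "\<dots> > 0" using True t(4) by simp
      finally show ?thesis using t by (intro bexI[of _ t']) auto
    next
      case False
      have "{i. i < m \<and> arm m Q i \<noteq> {}} \<inter> {i. i < m \<and> 0 < a \<bullet> v i} \<noteq> {}"
      proof
        assume "{i. i < m \<and> arm m Q i \<noteq> {}} \<inter> {i. i < m \<and> 0 < a \<bullet> v i} = {}"
        then have "card {i. i < m \<and> arm m Q i \<noteq> {}} + card {i. i < m \<and> 0 < a \<bullet> v i}
            = card ({i. i < m \<and> arm m Q i \<noteq> {}} \<union> {i. i < m \<and> 0 < a \<bullet> v i})"
          by (intro card_Un_disjoint[symmetric]) auto
        also have "\<dots> \<le> card {..<m}" by (intro card_mono) auto
        finally show False using I rays[OF \<open>a \<noteq> 0\<close>] by simp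
      qed
      then obtain i s where i: "i < m" "s \<in> arm m Q i" "0 < a \<bullet> v i" by auto
      define t'' where "t'' = s * m + i"
      have t'': "t'' \<in> Q" "t'' mod m = i" using i by (auto simp: t''_def arm_def)
      have "0 < h (t'' div m)" using Q t''(1) by (intro hpos div_less) auto
      then have "0 < a \<bullet> y t''" using t''(2) i(3) by (simp add: y_def)
      moreover have "a \<bullet> y t \<le> 0" using False t0 by (simp add: y_def mult_nonneg_nonpos)
      ultimately show ?thesis using t'' i False by (intro bexI[of _ t'']) (auto simp: inner_diff_right)
    qed
  qed
  obtain \<delta> where "0 < \<delta>" and
    \<delta>: "\<And>p' Q t. (\<And>s. s \<in> {..<m * M} \<Longrightarrow> dist (p' s) (y s) < \<delta>) \<Longrightarrow> Q \<subseteq> {..<m * M} \<Longrightarrow> t \<in> Q \<Longrightarrow>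
       removable p' Q t \<Longrightarrow> removable y Q t"
    using removable_stable[of "{..<m * M}" y] by blast
  define L where "L = (\<Sum>s<M. norm (q s)) + 1"
  have "0 < L" unfolding L_def by (intro add_nonneg_pos sum_nonneg) auto
  have qL: "norm (q s) < L" if "s < M" for s
  proof -
    have "norm (q s) \<le> (\<Sum>s<M. norm (q s))" using that by (intro member_le_sum) auto
    then show ?thesis by (simp add: L_def)
  qed
  \<comment> \<open>For \<open>\<epsilon> = - (w \<bullet> v i)\<close> the linear part \<open>x \<mapsto> (w \<bullet> x) *\<^sub>R v i + \<epsilon> *\<^sub>R x\<close> has \<open>v i\<close> in its kernel.\<close>
  have "infinite {0<..<\<delta> / L}" using \<open>0 < \<delta>\<close> \<open>0 < L\<close> by (simp add: infinite_Ioo)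
  then have "{0<..<\<delta> / L} - (\<lambda>i. - (w \<bullet> v i)) ` {..<m} \<noteq> {}"
    by (metis Diff_eq_empty_iff finite_imageI finite_lessThan finite_subset)
  then obtain \<epsilon> where "\<epsilon> \<in> {0<..<\<delta> / L} - (\<lambda>i. - (w \<bullet> v i)) ` {..<m}" by blast
  then have \<epsilon>: "0 < \<epsilon>" "\<epsilon> < \<delta> / L" "\<And>i. i < m \<Longrightarrow> \<epsilon> \<noteq> - (w \<bullet> v i)" by auto
  define p where "p t = y t + \<epsilon> *\<^sub>R q (t div m)" for t
  have close: "dist (p t) (y t) < \<delta>" if "t \<in> {..<m * M}" for t
  proof -
    have "dist (p t) (y t) = \<epsilon> * norm (q (t div m))" using \<epsilon>(1) by (simp add: p_def dist_norm)
    also have "\<dots> < \<epsilon> * L" using \<epsilon>(1) that by (simp add: qL div_less)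
    also have "\<dots> < \<delta>" using \<epsilon>(2) \<open>0 < L\<close> by (simp add: field_simps)
    finally show ?thesis .
  qed
  show thesis
  proof (rule that)
    fix Q t assume Q: "Q \<subseteq> {..<m * M}" "t \<in> Q" "removable p Q t"
    define i where "i = t mod m"
    have "i < m" using \<open>0 < m\<close> by (simp add: i_def)
    show "removable q (arm m Q (t mod m)) (t div m)"
    proof (rule ccontr)
      assume "\<not> ?thesis"
      then have s: "surrounds (arm m Q i - {t div m}) q (q (t div m))"
        by (simp add: removable_def i_def)
      have "surrounds (Q - {t}) p (p t)"
        unfolding surrounds_def
      proof (intro allI impI)
        fix a :: 'a assume "a \<noteq> 0"
        \<comment> \<open>The image of \<open>a\<close> under the adjoint of the linear part of the flattening map.\<close>
        define b where "b = (a \<bullet> v i) *\<^sub>R w + \<epsilon> *\<^sub>R a"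
        have "b \<noteq> 0"
        proof
          assume b0: "b = 0"
          then have "b \<bullet> v i = 0" by simp
          then have "(a \<bullet> v i) * (w \<bullet> v i + \<epsilon>) = 0" by (simp add: b_def inner_add_left algebra_simps)
          then have "a \<bullet> v i = 0" using \<epsilon>(3)[OF \<open>i < m\<close>] by auto
          then show False using b0 \<open>a \<noteq> 0\<close> \<epsilon>(1) by (simp add: b_def)
        qed
        then obtain s where s: "s \<in> arm m Q i" "s \<noteq> t div m" "0 < b \<bullet> (q s - q (t div m))"
          using s unfolding surrounds_def by blast
        define t' where "t' = s * m + i"
        have t': "t' \<in> Q" "t' div m = s" "t' mod m = i"
          using s(1) \<open>i < m\<close> by (auto simp: t'_def arm_def)
        have "a \<bullet> (p t' - p t) = b \<bullet> (q s - q (t div m))"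
          using t' by (simp add: p_def y_def h_def b_def i_def[symmetric] inner_diff_right inner_add_left
              inner_add_right algebra_simps inner_commute)
        then show "\<exists>t'\<in>Q - {t}. 0 < a \<bullet> (p t' - p t)"
          using t' s by (intro bexI[of _ t']) auto
      qed
      then show False using Q(3) by (simp add: removable_def)
    qed
  next
    fix Q assume Q: "Q \<subseteq> {..<m * M}" "m < j + card {i. i < m \<and> arm m Q i \<noteq> {}}"
    show "inj_on (\<lambda>t. t mod m) {t \<in> Q. removable p Q t}"
    proof (rule inj_onI)
      fix t t' assume "t \<in> {t \<in> Q. removable p Q t}" "t' \<in> {t \<in> Q. removable p Q t}"
        and eq: "t mod m = t' mod m"
      then have t: "t \<in> Q" "t' \<in> Q" and r: "removable p Q t" "removable p Q t'" by auto
      have ry: "removable y Q t" "removable y Q t'"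
        using \<delta>[of p Q] close Q(1) t r by blast+
      have "\<not> h (t div m) < h (t' div m)" "\<not> h (t' div m) < h (t div m)"
        using inner_hidden[OF Q] t eq ry by metis+
      then have "h (t div m) = h (t' div m)" by simp
      then have "t div m = t' div m" using hinj div_less t Q(1) by (metis lessThan_iff subsetD)
      then show "t = t'" using eq by (metis div_mult_mod_eq)
    qed
  qed
qed

section \<open>Counting removal orders\<close>

text \<open>Here \<open>R Q t\<close> means that \<open>t\<close> may be removed when \<open>Q\<close> is the set of remaining elements, and \<open>n\<close> is
the number of removals still to be made.\<close>

primrec removal_orders :: "('i set \<Rightarrow> 'i \<Rightarrow> bool) \<Rightarrow> nat \<Rightarrow> 'i set \<Rightarrow> nat" where
  "removal_orders R 0 Q = 1"
| "removal_orders R (Suc n) Q = (\<Sum>t\<in>{t\<in>Q. R Q t}. removal_orders R n (Q - {t}))"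

definition num_orders :: "('i set \<Rightarrow> 'i \<Rightarrow> bool) \<Rightarrow> 'i set \<Rightarrow> nat" where
  "num_orders R Q = removal_orders R (card Q) Q"

lemma num_orders_empty [simp]: "num_orders R {} = 1"
  by (simp add: num_orders_def)

lemma num_orders_rec:
  assumes "finite Q" "Q \<noteq> {}"
  shows "num_orders R Q = (\<Sum>t\<in>{t\<in>Q. R Q t}. num_orders R (Q - {t}))"
proof -
  obtain n where n: "card Q = Suc n" using assms by (metis card_0_eq not0_implies_Suc)
  then have c: "card (Q - {t}) = n" if "t \<in> Q" for t using that assms(1) by simp
  have "num_orders R Q = (\<Sum>t\<in>{t\<in>Q. R Q t}. removal_orders R n (Q - {t}))"
    by (simp add: num_orders_def n)
  also have "\<dots> = (\<Sum>t\<in>{t\<in>Q. R Q t}. num_orders R (Q - {t}))"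
    unfolding num_orders_def by (intro sum.cong refl) (use c in auto)
  finally show ?thesis .
qed

lemma num_orders_mono:
  assumes "finite Q" "\<And>Q' t. Q' \<subseteq> Q \<Longrightarrow> t \<in> Q' \<Longrightarrow> R Q' t \<Longrightarrow> R' Q' t"
  shows "num_orders R Q \<le> num_orders R' Q"
  using assms
proof (induction "card Q" arbitrary: Q)
  case 0
  then show ?case by simp
next
  case (Suc n)
  then have ne: "Q \<noteq> {}" by auto
  have "num_orders R (Q - {t}) \<le> num_orders R' (Q - {t})" if "t \<in> Q" for t
    using Suc that by (intro Suc.hyps(1)) auto
  moreover have "{t\<in>Q. R Q t} \<subseteq> {t\<in>Q. R' Q t}" using Suc.prems(2) by auto
  ultimately show ?case
    unfolding num_orders_rec[OF Suc.prems(1) ne]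
    by (intro order.trans[OF sum_mono sum_mono2]) (use Suc.prems(1) in auto)
qed

lemma mem_arm_iff: "t div m \<in> arm m Q (t mod m) \<longleftrightarrow> t \<in> Q"
  by (simp add: arm_def)

lemma finite_arm: "finite Q \<Longrightarrow> 0 < m \<Longrightarrow> finite (arm m Q i)"
  using finite_vimageI[of Q "\<lambda>s. s * m + i"] by (simp add: arm_def vimage_def inj_def)

lemma arm_empty [simp]: "arm m {} i = {}"
  by (simp add: arm_def)

lemma arm_remove:
  assumes "i < m"
  shows "arm m (Q - {t}) i = (if i = t mod m then arm m Q i - {t div m} else arm m Q i)"
proof -
  have "s * m + i = t \<longleftrightarrow> i = t mod m \<and> s = t div m" for s
    using assms by auto
  then show ?thesis by (auto simp: arm_def)
qed

lemma sum_over_arms: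
  fixes f :: "nat \<Rightarrow> nat \<Rightarrow> 'b::comm_monoid_add"
  assumes "0 < m" "finite Q"
  shows "(\<Sum>t\<in>{t\<in>Q. P (t mod m) (t div m)}. f (t mod m) (t div m))
       = (\<Sum>i<m. \<Sum>s\<in>{s\<in>arm m Q i. P i s}. f i s)"
proof -
  have "(\<Sum>i<m. \<Sum>s\<in>{s\<in>arm m Q i. P i s}. f i s)
      = (\<Sum>(i, s)\<in>(SIGMA i:{..<m}. {s\<in>arm m Q i. P i s}). f i s)"
    using finite_arm[OF assms(2,1)] by (intro sum.Sigma) auto
  also have "\<dots> = (\<Sum>t\<in>{t\<in>Q. P (t mod m) (t div m)}. f (t mod m) (t div m))"
    using assms
    by (intro sum.reindex_bij_witness[of _ "\<lambda>t. (t mod m, t div m)" "\<lambda>(i, s). s * m + i"])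
       (auto simp: arm_def)
  finally show ?thesis by simp
qed

lemma sum_card_arms:
  assumes "0 < m" "finite Q"
  shows "(\<Sum>i<m. card (arm m Q i)) = card Q"
  using sum_over_arms[OF assms, where P = "\<lambda>_ _. True" and f = "\<lambda>_ _. 1::nat"] by simp

text \<open>A removal order of the whole is a shuffle of removal orders of the arms, and at each step there are
at most \<open>c\<close> nonempty arms from which to take the next element.\<close>

lemma num_orders_shuffle:
  assumes "0 < m" "finite Q" "card {i. i < m \<and> arm m Q i \<noteq> {}} \<le> c"
    and arms: "\<And>Q' t. Q' \<subseteq> Q \<Longrightarrow> t \<in> Q' \<Longrightarrow> R Q' t \<Longrightarrow> R' (arm m Q' (t mod m)) (t div m)"
  shows "num_orders R Q \<le> c ^ card Q * (\<Prod>i<m. num_orders R' (arm m Q i))"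
  using assms(2-)
proof (induction "card Q" arbitrary: Q)
  case 0
  have "Q = {}" using 0(1,2) by simp
  then show ?case by simp
next
  case (Suc n)
  let ?N = "\<lambda>Q. num_orders R' Q"
  let ?I = "{i. i < m \<and> arm m Q i \<noteq> {}}"
  have ne: "Q \<noteq> {}" and fin: "finite Q" using Suc.hyps(2) Suc.prems(1) by auto
  have "num_orders R Q = (\<Sum>t\<in>{t\<in>Q. R Q t}. num_orders R (Q - {t}))"
    using num_orders_rec[OF fin ne] .
  also have "\<dots> \<le> (\<Sum>t\<in>{t\<in>Q. R Q t}. c ^ n * (\<Prod>i<m. ?N (arm m (Q - {t}) i)))"
  proof (rule sum_mono)
    fix t assume t: "t \<in> {t \<in> Q. R Q t}"
    then have cn: "card (Q - {t}) = n" using Suc.hyps(2) fin by simp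
    have "{i. i < m \<and> arm m (Q - {t}) i \<noteq> {}} \<subseteq> ?I" by (auto simp: arm_def)
    then have "card {i. i < m \<and> arm m (Q - {t}) i \<noteq> {}} \<le> c"
      by (intro order.trans[OF card_mono Suc.prems(2)]) auto
    then show "num_orders R (Q - {t}) \<le> c ^ n * (\<Prod>i<m. ?N (arm m (Q - {t}) i))"
      using Suc.hyps(1)[of "Q - {t}"] cn fin Suc.prems(3) by blast
  qed
  also have "\<dots> \<le> (\<Sum>t\<in>{t\<in>Q. R' (arm m Q (t mod m)) (t div m)}. c ^ n * (\<Prod>i<m. ?N (arm m (Q - {t}) i)))"
    using Suc.prems(3)[of Q] fin by (intro sum_mono2) auto
  also have "\<dots> = (\<Sum>t\<in>{t\<in>Q. R' (arm m Q (t mod m)) (t div m)}.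
      c ^ n * (?N (arm m Q (t mod m) - {t div m}) * (\<Prod>i\<in>{..<m} - {t mod m}. ?N (arm m Q i))))"
  proof (intro sum.cong refl arg_cong2[where f = "(*)"])
    fix t
    have "t mod m \<in> {..<m}" using assms(1) by simp
    then show "(\<Prod>i<m. ?N (arm m (Q - {t}) i)) =
       ?N (arm m Q (t mod m) - {t div m}) * (\<Prod>i\<in>{..<m} - {t mod m}. ?N (arm m Q i))"
      by (subst prod.remove) (auto simp: arm_remove)
  qed
  also have "\<dots> = (\<Sum>i<m. \<Sum>s\<in>{s\<in>arm m Q i. R' (arm m Q i) s}.
      c ^ n * (?N (arm m Q i - {s}) * (\<Prod>i'\<in>{..<m} - {i}. ?N (arm m Q i'))))"
    using assms(1) fin by (rule sum_over_arms)
  also have "\<dots> = (\<Sum>i\<in>?I. \<Sum>s\<in>{s\<in>arm m Q i. R' (arm m Q i) s}.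
      c ^ n * (?N (arm m Q i - {s}) * (\<Prod>i'\<in>{..<m} - {i}. ?N (arm m Q i'))))"
    by (intro sum.mono_neutral_right) auto
  also have "\<dots> = (\<Sum>i\<in>?I. c ^ n * (\<Prod>i<m. ?N (arm m Q i)))"
  proof (intro sum.cong refl)
    fix i assume i: "i \<in> ?I"
    then have "?N (arm m Q i) = (\<Sum>s\<in>{s\<in>arm m Q i. R' (arm m Q i) s}. ?N (arm m Q i - {s}))"
      using finite_arm[OF fin assms(1)] by (intro num_orders_rec) auto
    moreover have "(\<Prod>i<m. ?N (arm m Q i)) = ?N (arm m Q i) * (\<Prod>i'\<in>{..<m} - {i}. ?N (arm m Q i'))"
      using i by (subst prod.remove) auto
    ultimately show "(\<Sum>s\<in>{s\<in>arm m Q i. R' (arm m Q i) s}.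
      c ^ n * (?N (arm m Q i - {s}) * (\<Prod>i'\<in>{..<m} - {i}. ?N (arm m Q i')))) = c ^ n * (\<Prod>i<m. ?N (arm m Q i))"
      by (simp add: sum_distrib_left sum_distrib_right mult_ac)
  qed
  also have "\<dots> \<le> c * (c ^ n * (\<Prod>i<m. ?N (arm m Q i)))"
    using Suc.prems(2) by simp
  finally show ?case using Suc.hyps(2)[symmetric] by (simp add: mult_ac)
qed

lemma arm_subset_interval:
  assumes "Q \<subseteq> {..<N}" "i < m"
  shows "arm m Q i \<subseteq> {..<(N + m - 1 - i) div m}"
proof
  fix s assume "s \<in> arm m Q i"
  then have "s * m + i < N" using assms(1) by (auto simp: arm_def)
  then have "Suc s * m \<le> N + m - 1 - i" using assms(2) by simp
  then have "Suc s \<le> (N + m - 1 - i) div m"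
    using assms(2) by (metis div_le_mono nonzero_mult_div_cancel_right not_less_zero)
  then show "s \<in> {..<(N + m - 1 - i) div m}" by simp
qed

lemma arm_interval:
  assumes "i < m"
  shows "arm m {..<N} i = {..<(N + m - 1 - i) div m}"
proof
  show "arm m {..<N} i \<subseteq> {..<(N + m - 1 - i) div m}"
    using assms by (intro arm_subset_interval) auto
  show "{..<(N + m - 1 - i) div m} \<subseteq> arm m {..<N} i"
  proof
    fix s assume "s \<in> {..<(N + m - 1 - i) div m}"
    then have "Suc s * m \<le> (N + m - 1 - i) div m * m" by (intro mult_le_mono1) auto
    also have "\<dots> \<le> N + m - 1 - i" by simp
    finally show "s \<in> arm m {..<N} i" using assms by (auto simp: arm_def)
  qed
qed

section \<open>The recursion over stars\<close>

text \<open>As long as more than \<open>c\<close> arms are present, each of them offers only its tip; afterwards the remaining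
\<open>c\<close> arms are at worst shuffled, and within an arm the bound for its copy applies. The proof adds up
over the sets \<open>J\<close> of \<open>j\<close> arms that may be exhausted first. The weight \<open>W J\<close> gains a factor \<open>c\<close> for
every point outside these arms, and the factor \<open>(j + 1) ^ card Q\<close> pays for one removal: the at most
\<open>j\<close> tips in \<open>J\<close> leave \<open>W J\<close> unchanged, and the at most \<open>c\<close> other tips divide it by \<open>c\<close>, so that the sum
over all tips is at most \<open>j * W J + c * (W J / c) = (j + 1) * W J\<close>.

The base \<open>\<gamma>\<close> depends on the size \<open>N\<close> of the original configuration and not on \<open>card Q\<close>, which is what
makes the induction close: nothing is known about how the points left in an arm are distributed over
its own sub-arms. The equation \<open>\<gamma> ^ j = c ^ c\<close> balances the \<open>c\<close> shuffled arms against the \<open>j\<close> arms that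
have disappeared, all of them having nearly equal size.\<close>

lemma num_orders_star:
  fixes \<gamma> E :: real
  assumes m: "m = c + j" and cj: "1 \<le> c" "1 \<le> j"
    and \<gamma>: "1 \<le> \<gamma>" "\<gamma> ^ j = real c ^ c" and "0 < E"
    and arms: "\<And>Q t. Q \<subseteq> {..<m * M} \<Longrightarrow> t \<in> Q \<Longrightarrow> R Q t \<Longrightarrow> R' (arm m Q (t mod m)) (t div m)"
    and tips: "\<And>Q. Q \<subseteq> {..<m * M} \<Longrightarrow> c < card {i. i < m \<and> arm m Q i \<noteq> {}} \<Longrightarrow>
       inj_on (\<lambda>t. t mod m) {t \<in> Q. R Q t}"
    and bound: "\<And>N Q. N \<le> M \<Longrightarrow> Q \<subseteq> {..<N} \<Longrightarrow> num_orders R' Q \<le> E * (real j + 1) ^ card Q * \<gamma> ^ N"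
    and N: "N \<le> m * M" and Q: "Q \<subseteq> {..<N}"
  shows "num_orders R Q \<le> (2 ^ m * real c ^ c * E ^ c) * (real j + 1) ^ card Q * \<gamma> ^ N"
proof -
  have "0 < m" using m cj by simp
  \<comment> \<open>The number of points that arm \<open>i\<close> contributes to the first \<open>N\<close> points.\<close>
  define n where "n i = (N + m - 1 - i) div m" for i
  define \<J> where "\<J> = {J. J \<subseteq> {..<m} \<and> card J = j}"
  have "finite \<J>" by (simp add: \<J>_def)
  define W where "W J Q = real c ^ (\<Sum>i\<in>{..<m} - J. card (arm m Q i)) * \<gamma> ^ (\<Sum>i\<in>{..<m} - J. n i)" for J Q
  have W0: "0 \<le> W J Q" for J Q using \<gamma> by (simp add: W_def)
  have nM: "n i \<le> M" for i
  proof -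
    have "N + m - 1 - i \<le> M * m + (m - 1)" using N by (simp add: mult.commute)
    then have "n i \<le> (M * m + (m - 1)) div m" unfolding n_def by (rule div_le_mono)
    also have "\<dots> = M" using \<open>0 < m\<close> by (intro div_nat_eqI) (auto simp: mult.commute)
    finally show ?thesis .
  qed
  have cardJc: "card ({..<m} - J) = c" if "J \<in> \<J>" for J
    using that m by (auto simp: \<J>_def card_Diff_subset finite_subset)
  have potential: "num_orders R Q \<le> E ^ c * (real j + 1) ^ card Q * (\<Sum>J\<in>\<J>. W J Q)" if "Q \<subseteq> {..<N}" for Q
    using that
  proof (induction "card Q" arbitrary: Q rule: less_induct)
    case less
    have fin: "finite Q" using less.prems finite_subset by blast
    have sub: "Q \<subseteq> {..<m * M}" using less.prems N by auto
    let ?I = "{i. i < m \<and> arm m Q i \<noteq> {}}"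
    show ?case
    proof (cases "card ?I \<le> c")
      case True
      \<comment> \<open>At least \<open>j\<close> arms are empty, and the summand of \<open>j\<close> empty arms already suffices.\<close>
      have "card ({..<m} - ?I) = m - card ?I" by (subst card_Diff_subset) auto
      then have "j \<le> card ({..<m} - ?I)" using True m by simp
      from obtain_subset_with_card_n[OF this] obtain J where J: "J \<subseteq> {..<m} - ?I" "card J = j"
        by blast
      then have JJ: "J \<in> \<J>" by (auto simp: \<J>_def)
      have empty: "arm m Q i = {}" if "i \<in> J" for i using J that by auto
      have Jm: "J \<subseteq> {..<m}" using J by auto
      have "card Q = (\<Sum>i<m. card (arm m Q i))" using sum_card_arms[OF \<open>0 < m\<close> fin] by simp
      also have "\<dots> = (\<Sum>i\<in>{..<m} - J. card (arm m Q i))"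
        using Jm empty by (intro sum.mono_neutral_right) auto
      finally have cQ: "card Q = (\<Sum>i\<in>{..<m} - J. card (arm m Q i))" .
      have "real (num_orders R Q) \<le> real (c ^ card Q * (\<Prod>i<m. num_orders R' (arm m Q i)))"
        using num_orders_shuffle[OF \<open>0 < m\<close> fin True, of R R'] arms sub
        by (metis (no_types, lifting) dual_order.trans of_nat_mono)
      also have "(\<Prod>i<m. num_orders R' (arm m Q i)) = (\<Prod>i\<in>{..<m} - J. num_orders R' (arm m Q i))"
        using Jm empty by (intro prod.mono_neutral_right) auto
      also have "real (c ^ card Q * (\<Prod>i\<in>{..<m} - J. num_orders R' (arm m Q i)))
          = real c ^ card Q * (\<Prod>i\<in>{..<m} - J. real (num_orders R' (arm m Q i)))" by simp
      also have "\<dots> \<le> real c ^ card Q * (\<Prod>i\<in>{..<m} - J. E * (real j + 1) ^ card (arm m Q i) * \<gamma> ^ n i)"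
        using arm_subset_interval[OF less.prems] nM
        by (intro mult_left_mono prod_mono conjI bound) (auto simp: n_def)
      also have "\<dots> = E ^ c * (real j + 1) ^ card Q * W J Q"
        by (simp add: prod.distrib cardJc[OF JJ] power_sum[symmetric] W_def cQ)
      also have "\<dots> \<le> E ^ c * (real j + 1) ^ card Q * (\<Sum>J\<in>\<J>. W J Q)"
        using \<open>0 < E\<close> W0 \<open>finite \<J>\<close> JJ by (intro mult_left_mono member_le_sum) auto
      finally show ?thesis .
    next
      case False
      have ne: "Q \<noteq> {}"
      proof
        assume "Q = {}"
        then show False using False by simp
      qed
      obtain k where k: "card Q = Suc k" using fin ne by (metis card_0_eq not0_implies_Suc)
      let ?X = "{t \<in> Q. R Q t}"
      have finX: "finite ?X" using fin by simp
      have inj: "inj_on (\<lambda>t. t mod m) ?X" using tips[OF sub] False by simp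
      have step: "(\<Sum>t\<in>?X. W J (Q - {t})) \<le> (real j + 1) * W J Q" if J: "J \<in> \<J>" for J
      proof -
        let ?A = "{t \<in> ?X. t mod m \<in> J}" and ?B = "{t \<in> ?X. t mod m \<notin> J}"
        have "card ?A = card ((\<lambda>t. t mod m) ` ?A)"
          by (rule card_image[symmetric], rule inj_on_subset[OF inj]) auto
        also have "\<dots> \<le> card J" using J by (intro card_mono) (auto simp: \<J>_def finite_subset)
        also have "\<dots> = j" using J by (simp add: \<J>_def)
        finally have cA: "card ?A \<le> j" .
        have "card ?B = card ((\<lambda>t. t mod m) ` ?B)"
          by (rule card_image[symmetric], rule inj_on_subset[OF inj]) auto
        also have "\<dots> \<le> card ({..<m} - J)" using \<open>0 < m\<close> by (intro card_mono) auto
        also have "\<dots> = c" using J by (rule cardJc)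
        finally have cB: "card ?B \<le> c" .
        have WA: "W J (Q - {t}) = W J Q" if "t \<in> ?A" for t
        proof -
          have "arm m (Q - {t}) i = arm m Q i" if "i \<in> {..<m} - J" for i
            using that \<open>t \<in> ?A\<close> by (auto simp: arm_remove)
          then show ?thesis by (simp add: W_def)
        qed
        have WB: "real c * W J (Q - {t}) = W J Q" if t: "t \<in> ?B" for t
        proof -
          have mem: "t mod m \<in> {..<m} - J" using t \<open>0 < m\<close> by auto
          have "t div m \<in> arm m Q (t mod m)" using t by (simp add: mem_arm_iff)
          then have "card (arm m Q (t mod m)) = Suc (card (arm m Q (t mod m) - {t div m}))"
            using card_Suc_Diff1[OF finite_arm[OF fin \<open>0 < m\<close>]] by metis
          then have "(\<Sum>i\<in>{..<m} - J. card (arm m Q i)) = Suc (\<Sum>i\<in>{..<m} - J. card (arm m (Q - {t}) i))"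
            unfolding sum.remove[OF _ mem, simplified] using \<open>0 < m\<close> by (simp add: arm_remove)
          then show ?thesis by (simp add: W_def)
        qed
        have "(\<Sum>t\<in>?X. W J (Q - {t})) = (\<Sum>t\<in>?A. W J (Q - {t})) + (\<Sum>t\<in>?B. W J (Q - {t}))"
          using fin by (subst sum.union_disjoint[symmetric]) (auto intro!: sum.cong)
        also have "(\<Sum>t\<in>?A. W J (Q - {t})) = card ?A * W J Q"
          using WA by simp
        also have "(\<Sum>t\<in>?B. W J (Q - {t})) = (\<Sum>t\<in>?B. W J Q / c)"
          using WB cj by (intro sum.cong) (auto simp: field_simps)
        also have "(\<Sum>t\<in>?B. W J Q / c) = card ?B * (W J Q / c)" by simp
        also have "card ?A * W J Q + card ?B * (W J Q / c) \<le> j * W J Q + c * (W J Q / c)"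
          by (intro add_mono mult_right_mono of_nat_mono cA cB divide_nonneg_nonneg W0 of_nat_0_le_iff)
        also have "\<dots> = (real j + 1) * W J Q" using cj by (simp add: algebra_simps)
        finally show ?thesis .
      qed
      have "real (num_orders R Q) = (\<Sum>t\<in>?X. real (num_orders R (Q - {t})))"
        unfolding num_orders_rec[OF fin ne] by simp
      also have "\<dots> \<le> (\<Sum>t\<in>?X. E ^ c * (real j + 1) ^ k * (\<Sum>J\<in>\<J>. W J (Q - {t})))"
      proof (rule sum_mono)
        fix t assume "t \<in> ?X"
        then have "card (Q - {t}) = k" using fin k by simp
        then show "real (num_orders R (Q - {t})) \<le> E ^ c * (real j + 1) ^ k * (\<Sum>J\<in>\<J>. W J (Q - {t}))"
          using less.hyps[of "Q - {t}"] k less.prems by auto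
      qed
      also have "\<dots> = E ^ c * (real j + 1) ^ k * (\<Sum>J\<in>\<J>. \<Sum>t\<in>?X. W J (Q - {t}))"
        unfolding sum_distrib_left[symmetric] by (subst sum.swap) simp
      also have "\<dots> \<le> E ^ c * (real j + 1) ^ k * (\<Sum>J\<in>\<J>. (real j + 1) * W J Q)"
        using \<open>0 < E\<close> by (intro mult_left_mono sum_mono step) auto
      also have "\<dots> = E ^ c * (real j + 1) ^ card Q * (\<Sum>J\<in>\<J>. W J Q)"
        unfolding k sum_distrib_left[symmetric] power_Suc by (simp only: mult_ac)
      finally show ?thesis .
    qed
  qed
  \<comment> \<open>The sizes of the arms differ by at most one, which costs a factor \<open>c ^ c\<close>.\<close>
  have W_bound: "W J Q \<le> real c ^ c * \<gamma> ^ N" if J: "J \<in> \<J>" for J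
  proof -
    define b where "b = N div m"
    have n_lower: "b \<le> n i" if "i < m" for i
      unfolding b_def n_def using that by (intro div_le_mono) simp
    have n_upper: "n i \<le> Suc b" for i
    proof -
      have "n i \<le> (N + m) div m" unfolding n_def by (intro div_le_mono) simp
      then show ?thesis using \<open>0 < m\<close> by (simp add: b_def)
    qed
    have card_arm: "card (arm m Q i) \<le> n i" if "i < m" for i
      using card_mono[OF _ arm_subset_interval[OF Q that]] by (simp add: n_def)
    have "(\<Sum>i<m. n i) = (\<Sum>i<m. card (arm m {..<N} i))"
      by (intro sum.cong) (simp_all add: arm_interval n_def)
    also have "\<dots> = N" using sum_card_arms[OF \<open>0 < m\<close>, of "{..<N}"] by simp
    finally have total: "(\<Sum>i\<in>J. n i) + (\<Sum>i\<in>{..<m} - J. n i) = N"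
      using J sum.subset_diff[of J "{..<m}" n] by (simp add: \<J>_def)
    have "(\<Sum>i\<in>{..<m} - J. card (arm m Q i)) \<le> (\<Sum>i\<in>{..<m} - J. Suc b)"
      using order.trans[OF card_arm n_upper] by (intro sum_mono) auto
    then have "real c ^ (\<Sum>i\<in>{..<m} - J. card (arm m Q i)) \<le> real c ^ (c * Suc b)"
      using cj cardJc[OF J] by (intro power_increasing) auto
    also have "\<dots> = real c ^ c * \<gamma> ^ (j * b)"
      unfolding power_mult \<gamma>(2) by (simp add: power_add power_mult)
    also have "\<dots> \<le> real c ^ c * \<gamma> ^ (\<Sum>i\<in>J. n i)"
    proof -
      have "(\<Sum>i\<in>J. b) \<le> (\<Sum>i\<in>J. n i)" using J n_lower by (intro sum_mono) (auto simp: \<J>_def)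
      then show ?thesis using J \<gamma>(1) by (intro mult_left_mono power_increasing) (auto simp: \<J>_def)
    qed
    finally have "W J Q \<le> real c ^ c * \<gamma> ^ (\<Sum>i\<in>J. n i) * \<gamma> ^ (\<Sum>i\<in>{..<m} - J. n i)"
      unfolding W_def using \<gamma>(1) by (intro mult_right_mono) auto
    also have "\<dots> = real c ^ c * \<gamma> ^ N" by (simp add: total[symmetric] power_add)
    finally show ?thesis .
  qed
  have "card \<J> \<le> card (Pow {..<m})" by (intro card_mono) (auto simp: \<J>_def)
  then have "card \<J> \<le> 2 ^ m" by (simp add: card_Pow)
  then have card\<J>: "real (card \<J>) \<le> 2 ^ m" using of_nat_mono by fastforce
  have "(\<Sum>J\<in>\<J>. W J Q) \<le> card \<J> * (real c ^ c * \<gamma> ^ N)"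
    by (intro sum_bounded_above W_bound)
  also have "\<dots> \<le> 2 ^ m * (real c ^ c * \<gamma> ^ N)"
    using card\<J> \<gamma>(1) by (intro mult_right_mono) auto
  finally have "E ^ c * (real j + 1) ^ card Q * (\<Sum>J\<in>\<J>. W J Q)
      \<le> E ^ c * (real j + 1) ^ card Q * (2 ^ m * (real c ^ c * \<gamma> ^ N))"
    using \<open>0 < E\<close> by (intro mult_left_mono) auto
  then show ?thesis using potential[OF Q] by (simp add: mult_ac)
qed

lemma num_peelings_le_num_orders:
  fixes p :: "'i \<Rightarrow> 'a::euclidean_space"
  assumes "finite Q" "inj_on p Q"
  shows "num_peelings (p ` Q) \<le> num_orders (removable p) Q"
  using assms
proof (induction "card Q" arbitrary: Q)
  case 0
  then have "Q = {}" by simp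
  moreover have "{ps. peeling_sequence {} (ps :: 'a list)} = {[]}"
    by (auto intro: peeling_sequence.Nil dest: peeling_sequence_distinct_set)
  ultimately show ?case by (simp add: num_peelings_def)
next
  case (Suc n)
  let ?P = "p ` Q"
  let ?X = "{t \<in> Q. removable p Q t}"
  have ne: "Q \<noteq> {}" using Suc.hyps(2) by auto
  have "{ps. peeling_sequence ?P ps} \<subseteq> (\<Union>t\<in>?X. (#) (p t) ` {ps. peeling_sequence (p ` (Q - {t})) ps})"
  proof
    fix ps assume "ps \<in> {ps. peeling_sequence ?P ps}"
    then have "peeling_sequence ?P ps" by simp
    then show "ps \<in> (\<Union>t\<in>?X. (#) (p t) ` {ps. peeling_sequence (p ` (Q - {t})) ps})"
    proof cases
      case Nil
      then show ?thesis using ne by simp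
    next
      case (Cons x qs)
      then obtain t where t: "t \<in> Q" "x = p t" using extreme_point_of_convex_hull by blast
      have "?P - {x} = p ` (Q - {t})" using Suc.prems(2) t by (auto simp: inj_on_def)
      then show ?thesis
        using Cons t extreme_imp_removable[OF Suc.prems t(1)] by auto
    qed
  qed
  then have "num_peelings ?P \<le> card (\<Union>t\<in>?X. (#) (p t) ` {ps. peeling_sequence (p ` (Q - {t})) ps})"
    unfolding num_peelings_def using Suc.prems(1)
    by (intro card_mono finite_UN_I finite_imageI finite_peeling_sequences) auto
  also have "\<dots> \<le> (\<Sum>t\<in>?X. card ((#) (p t) ` {ps. peeling_sequence (p ` (Q - {t})) ps}))"
    using Suc.prems(1) by (intro card_UN_le) simp
  also have "\<dots> = (\<Sum>t\<in>?X. num_peelings (p ` (Q - {t})))"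
    unfolding num_peelings_def by (intro sum.cong refl card_image) simp
  also have "\<dots> \<le> (\<Sum>t\<in>?X. num_orders (removable p) (Q - {t}))"
    using Suc by (intro sum_mono Suc.hyps(1)) (auto intro: inj_on_subset)
  also have "\<dots> = num_orders (removable p) Q"
    using num_orders_rec[OF Suc.prems(1) ne] by metis
  finally show ?case .
qed

text \<open>The factor lost at depth \<open>T\<close> grows only like the exponential of \<open>(c + 1) ^ T\<close>, since no more than \<open>c\<close>
of the \<open>m\<close> arms survive into the next level, whereas the number of points grows like \<open>m ^ T\<close>. Every
level starts with a perturbation that makes the points distinct; a functional can then order each
flattened copy along its ray.\<close>

lemma iterated_stars:
  fixes \<gamma> R :: real
  assumes j: "1 \<le> j" and c: "c = CARD('d::finite) + j - 1" and m: "m = c + j"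
    and \<gamma>: "1 \<le> \<gamma>" "\<gamma> ^ j = real c ^ c" and R: "R = 2 ^ m * real c ^ c"
  shows "\<exists>p :: nat \<Rightarrow> real ^ 'd. \<forall>N \<le> m ^ T. \<forall>Q \<subseteq> {..<N}.
     real (num_orders (removable p) Q) \<le> R ^ ((c + 1) ^ T) * (real j + 1) ^ card Q * \<gamma> ^ N"
proof (induction T)
  have c1: "1 \<le> c" using j c zero_less_card_finite[where 'a = 'd] by linarith
  have R1: "1 \<le> R" unfolding R using c1 by (intro mult_ge1_I one_le_power) auto
  case 0
  show ?case
  proof (intro exI allI impI)
    fix N Q assume N: "N \<le> m ^ 0" and Q: "Q \<subseteq> {..<N}"
    have "Q \<subseteq> {0}" using N Q by fastforce
    then have "Q = {} \<or> Q = {0}" by (rule subset_singletonD)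
    then have "num_orders (removable (\<lambda>_. 0 :: real ^ 'd)) Q \<le> 1"
    proof
      assume Q: "Q = {0}"
      let ?N = "num_orders (removable (\<lambda>_. 0 :: real ^ 'd))"
      have "?N Q = (\<Sum>t\<in>{t\<in>Q. removable (\<lambda>_. 0 :: real ^ 'd) Q t}. ?N (Q - {t}))"
        using Q by (intro num_orders_rec) auto
      also have "\<dots> \<le> (\<Sum>t\<in>Q. ?N (Q - {t}))" using Q by (intro sum_mono2) auto
      also have "\<dots> = 1" by (simp add: Q)
      finally show ?thesis .
    qed simp
    moreover have "1 \<le> R ^ ((c + 1) ^ 0) * (real j + 1) ^ card Q * \<gamma> ^ N"
      using R1 \<gamma>(1) by (intro mult_ge1_I one_le_power) auto
    ultimately show "real (num_orders (removable (\<lambda>_. 0 :: real ^ 'd)) Q)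
      \<le> R ^ ((c + 1) ^ 0) * (real j + 1) ^ card Q * \<gamma> ^ N" by linarith
  qed
next
  have c1: "1 \<le> c" using j c zero_less_card_finite[where 'a = 'd] by linarith
  have R1: "1 \<le> R" unfolding R using c1 by (intro mult_ge1_I one_le_power) auto
  case (Suc T)
  define M where "M = m ^ T"
  define E where "E = R ^ ((c + 1) ^ T)"
  have "0 < E" using R1 by (simp add: E_def)
  obtain q0 :: "nat \<Rightarrow> real ^ 'd" where q0: "\<And>N Q. N \<le> M \<Longrightarrow> Q \<subseteq> {..<N} \<Longrightarrow>
      real (num_orders (removable q0) Q) \<le> E * (real j + 1) ^ card Q * \<gamma> ^ N"
    using Suc.IH by (auto simp: M_def E_def)
  obtain \<delta> where "0 < \<delta>" and \<delta>: "\<And>p' Q t. (\<And>s. s \<in> {..<M} \<Longrightarrow> dist (p' s) (q0 s) < \<delta>) \<Longrightarrow>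
      Q \<subseteq> {..<M} \<Longrightarrow> t \<in> Q \<Longrightarrow> removable p' Q t \<Longrightarrow> removable q0 Q t"
    using removable_stable[of "{..<M}" q0] by blast
  obtain q where q: "\<And>t. t < M \<Longrightarrow> dist (q t) (q0 t) < \<delta>" "inj_on q {..<M}"
    using general_position_perturbation[OF \<open>0 < \<delta>\<close>, of M q0] by blast
  have bound: "real (num_orders (removable q) Q) \<le> E * (real j + 1) ^ card Q * \<gamma> ^ N"
    if "N \<le> M" "Q \<subseteq> {..<N}" for N Q
  proof -
    have "num_orders (removable q) Q \<le> num_orders (removable q0) Q"
    proof (rule num_orders_mono)
      show "finite Q" using that(2) finite_subset by blast
      fix Q' t assume Q': "Q' \<subseteq> Q" "t \<in> Q'" "removable q Q' t"
      have "Q' \<subseteq> {..<M}" using Q'(1) that by auto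
      then show "removable q0 Q' t" using \<delta>[of q Q' t] q(1) Q' by blast
    qed
    then show ?thesis using q0[OF that] by linarith
  qed
  obtain v :: "nat \<Rightarrow> real ^ 'd" where
    "\<And>a. a \<noteq> 0 \<Longrightarrow> j \<le> card {i. i < CARD('d) + 2 * j - 1 \<and> 0 < a \<bullet> v i}"
    using rays_meeting_every_halfspace[where 'd = 'd and j = j] by blast
  moreover have "CARD('d) + 2 * j - 1 = m" using m c j by simp
  ultimately have v: "\<And>a. a \<noteq> 0 \<Longrightarrow> j \<le> card {i. i < m \<and> 0 < a \<bullet> v i}" by simp
  have "0 < m" using m j by simp
  obtain p :: "nat \<Rightarrow> real ^ 'd" where p1:
    "\<And>Q t. Q \<subseteq> {..<m * M} \<Longrightarrow> t \<in> Q \<Longrightarrow> removable p Q t \<Longrightarrow> removable q (arm m Q (t mod m)) (t div m)"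
    and p2: "\<And>Q. Q \<subseteq> {..<m * M} \<Longrightarrow> m < j + card {i. i < m \<and> arm m Q i \<noteq> {}} \<Longrightarrow>
       inj_on (\<lambda>t. t mod m) {t \<in> Q. removable p Q t}"
    using star_of_copies[OF \<open>0 < m\<close> q(2) v] by blast
  have E': "2 ^ m * real c ^ c * E ^ c \<le> R ^ ((c + 1) ^ Suc T)"
  proof -
    have "2 ^ m * real c ^ c * E ^ c = R ^ (1 + (c + 1) ^ T * c)"
      by (simp add: R[symmetric] E_def power_mult)
    also have "\<dots> \<le> R ^ ((c + 1) ^ Suc T)"
      using R1 by (intro power_increasing) (auto simp: algebra_simps Suc_leI)
    finally show ?thesis .
  qed
  show ?case
  proof (intro exI allI impI)
    fix N Q assume N: "N \<le> m ^ Suc T" and Q: "Q \<subseteq> {..<N}"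
    have "real (num_orders (removable p) Q)
        \<le> (2 ^ m * real c ^ c * E ^ c) * (real j + 1) ^ card Q * \<gamma> ^ N"
    proof (rule num_orders_star[OF m c1 j \<gamma> \<open>0 < E\<close> p1 _ bound _ Q])
      show "N \<le> m * M" using N by (simp add: M_def)
      fix Q assume "Q \<subseteq> {..<m * M}" "c < card {i. i < m \<and> arm m Q i \<noteq> {}}"
      then show "inj_on (\<lambda>t. t mod m) {t \<in> Q. removable p Q t}" using m by (intro p2) auto
    qed
    also have "\<dots> \<le> R ^ ((c + 1) ^ Suc T) * (real j + 1) ^ card Q * \<gamma> ^ N"
      using E' \<gamma>(1) by (intro mult_right_mono) auto
    finally show "real (num_orders (removable p) Q) \<le> R ^ ((c + 1) ^ Suc T) * (real j + 1) ^ card Q * \<gamma> ^ N" .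
  qed
qed

section \<open>The exponential bound\<close>

lemma tower_absorbed_by_exponential:
  fixes s R :: real
  assumes "1 < s" "1 \<le> R" "1 \<le> b" "b < m"
  obtains C where "0 < C" "\<And>T N. m ^ T \<le> m * N \<Longrightarrow> R ^ (b ^ T) \<le> C * s ^ N"
proof -
  have "(\<lambda>T. (real b / real m) ^ T * (real m * ln R)) \<longlonglongrightarrow> 0 * (real m * ln R)"
    using assms(4) by (intro tendsto_mult_right LIMSEQ_realpow_zero) auto
  then have "\<forall>\<^sub>F T in sequentially. (real b / real m) ^ T * (real m * ln R) < ln s"
    using assms(1) by (intro order_tendstoD(2)[where a = "ln s"]) auto
  then obtain T0 where T0: "\<And>T. T0 \<le> T \<Longrightarrow> (real b / real m) ^ T * (real m * ln R) < ln s"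
    unfolding eventually_sequentially by blast
  define C where "C = R ^ (b ^ T0)"
  have C1: "1 \<le> C" using assms(2) by (simp add: C_def)
  show thesis
  proof (rule that)
    show "0 < C" using C1 by simp
    fix T N assume N: "m ^ T \<le> m * N"
    show "R ^ (b ^ T) \<le> C * s ^ N"
    proof (cases "T0 \<le> T")
      case True
      have "real m ^ T \<le> real m * real N" using N by (metis of_nat_le_iff of_nat_mult of_nat_power)
      have "real b ^ T * (real m * ln R) < real m ^ T * ln s"
        using T0[OF True] assms(4) by (simp add: power_divide field_simps)
      also have "\<dots> \<le> real m * real N * ln s"
        using \<open>real m ^ T \<le> _\<close> assms(1) by (intro mult_right_mono) auto
      finally have "real m * (real b ^ T * ln R) < real m * (real N * ln s)" by (simp add: mult_ac)
      then have "real (b ^ T) * ln R \<le> real N * ln s" using assms(4) by simp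
      then have "ln (R ^ (b ^ T)) \<le> ln (s ^ N)" using assms(1,2) by (simp add: ln_realpow)
      then have "R ^ (b ^ T) \<le> s ^ N" using assms(1,2) by simp
      also have "\<dots> \<le> C * s ^ N" using C1 assms(1) by simp
      finally show ?thesis .
    next
      case False
      then have "R ^ (b ^ T) \<le> C" unfolding C_def using assms(2,3) by (intro power_increasing) auto
      also have "\<dots> \<le> C * s ^ N" using C1 assms(1) by (simp add: one_le_power)
      finally show ?thesis .
    qed
  qed
qed

lemma few_peelings:
  fixes B :: real
  assumes j: "2 \<le> j" and c: "c = CARD('d::finite) + j - 1" 
    and B: "(real j + 1) * real c powr (real c / real j) < B"
  shows "\<exists>C>0. \<forall>n\<ge>1. \<exists>P :: (real ^ 'd) set. finite P \<and> card P = n \<and> general_position P \<and>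
     real (num_peelings P) \<le> C * B ^ n"
proof -
  define m where "m = c + j"
  define \<gamma> where "\<gamma> = real c powr (real c / real j)"
  define R where "R = 2 ^ m * real c ^ c"
  have c1: "1 \<le> c" using j c zero_less_card_finite[where 'a = 'd] by linarith
  have \<gamma>1: "1 \<le> \<gamma>" unfolding \<gamma>_def using c1 by (intro ge_one_powr_ge_zero) auto
  have \<gamma>j: "\<gamma> ^ j = real c ^ c"
    using c1 j by (simp add: \<gamma>_def powr_realpow[symmetric] powr_powr)
  have R1: "1 \<le> R" unfolding R_def using c1 by (intro mult_ge1_I one_le_power) auto
  define \<beta> where "\<beta> = (real j + 1) * \<gamma>"
  have "0 < \<beta>" using \<gamma>1 by (simp add: \<beta>_def)
  define s where "s = B / \<beta>"
  have "1 < s" using B \<open>0 < \<beta>\<close> by (simp add: s_def \<beta>_def \<gamma>_def)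
  obtain C where C: "0 < C" "\<And>T N. m ^ T \<le> m * N \<Longrightarrow> R ^ ((c + 1) ^ T) \<le> C * s ^ N"
    using tower_absorbed_by_exponential[OF \<open>1 < s\<close> R1, of "c + 1" m] j m_def by auto
  have "\<exists>P :: (real ^ 'd) set. finite P \<and> card P = n \<and> general_position P \<and>
     real (num_peelings P) \<le> C * B ^ n" if "1 \<le> n" for n
  proof -
    have "2 \<le> m" using j by (simp add: m_def)
    then obtain T0 where T0: "m ^ T0 \<le> n" "n < m ^ (T0 + 1)" using ex_power_ivl1 \<open>1 \<le> n\<close> by blast
    define T where "T = T0 + 1"
    have T: "n \<le> m ^ T" "m ^ T \<le> m * n" using T0 by (auto simp: T_def)
    obtain q :: "nat \<Rightarrow> real ^ 'd" where q: "\<And>N Q. N \<le> m ^ T \<Longrightarrow> Q \<subseteq> {..<N} \<Longrightarrow>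
        real (num_orders (removable q) Q) \<le> R ^ ((c + 1) ^ T) * (real j + 1) ^ card Q * \<gamma> ^ N"
      using iterated_stars[OF _ c m_def \<gamma>1 \<gamma>j R_def, of T] j by auto
    obtain \<delta> where "0 < \<delta>" and \<delta>: "\<And>p' Q t. (\<And>s. s \<in> {..<n} \<Longrightarrow> dist (p' s) (q s) < \<delta>) \<Longrightarrow>
        Q \<subseteq> {..<n} \<Longrightarrow> t \<in> Q \<Longrightarrow> removable p' Q t \<Longrightarrow> removable q Q t"
      using removable_stable[of "{..<n}" q] by blast
    obtain p where p: "\<And>t. t < n \<Longrightarrow> dist (p t) (q t) < \<delta>" "inj_on p {..<n}" "general_position (p ` {..<n})"
      using general_position_perturbation[OF \<open>0 < \<delta>\<close>, of n q] by blast
    have "num_peelings (p ` {..<n}) \<le> num_orders (removable p) {..<n}"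
      using p(2) by (intro num_peelings_le_num_orders) auto
    also have "\<dots> \<le> num_orders (removable q) {..<n}"
      using \<delta>[of p] p(1) by (intro num_orders_mono) auto
    finally have "real (num_peelings (p ` {..<n})) \<le> real (num_orders (removable q) {..<n})" by simp
    also have "\<dots> \<le> R ^ ((c + 1) ^ T) * \<beta> ^ n"
      using q[OF T(1), of "{..<n}"] by (simp add: \<beta>_def power_mult_distrib mult_ac)
    also have "\<dots> \<le> C * s ^ n * \<beta> ^ n"
      using C(2)[OF T(2)] \<open>0 < \<beta>\<close> by (intro mult_right_mono) auto
    also have "\<dots> = C * B ^ n" using \<open>0 < \<beta>\<close> by (simp add: s_def power_divide)
    finally show ?thesis using p(2,3) by (intro exI[of _ "p ` {..<n}"]) (auto simp: card_image)
  qed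
  then show ?thesis using C(1) by blast
qed

lemma min_peelings_le:
  fixes P :: "'a::euclidean_space set"
  assumes "finite P" "card P = n" "general_position P"
  shows "min_peelings TYPE('a) n \<le> num_peelings P"
  unfolding min_peelings_def using assms by (intro cINF_lower) auto

text \<open>The growth rate of the construction with \<open>j = k\<close> and \<open>c = d + k - 1\<close>. The inequality is strict
because \<open>k + 1 < D\<close>; the slack absorbs the subexponential factor of the recursion.\<close>

lemma growth_rate_bound:
  fixes d k :: nat and D :: real
  assumes "2 \<le> d" "1 \<le> k" "real d + real k \<le> D"
  shows "(real k + 1) * real (d + k - 1) powr (real (d + k - 1) / real k) < D powr (2 + (real d - 1) / real k)"
proof -
  have "real (d + k - 1) / real k = 1 + (real d - 1) / real k"
    using assms by (simp add: field_simps of_nat_diff)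
  then have "real (d + k - 1) powr (real (d + k - 1) / real k) \<le> D powr (1 + (real d - 1) / real k)"
    using assms by (auto intro!: powr_mono2)
  moreover have "real k + 1 < D" using assms by simp
  ultimately have "(real k + 1) * real (d + k - 1) powr (real (d + k - 1) / real k)
      < D * D powr (1 + (real d - 1) / real k)"
    using assms by (intro mult_less_le_imp_less) auto
  also have "\<dots> = D powr (2 + (real d - 1) / real k)"
    using \<open>real k + 1 < D\<close> by (subst powr_mult_base) (auto simp: add.assoc[symmetric])
  finally show ?thesis .
qed

theorem theorem1:
  fixes d :: nat
  assumes "d = CARD('d::finite)" and "d \<ge> 3"
  shows "\<exists>C::real. C > 0 \<and> (\<forall>n::nat. n \<ge> 2 \<longrightarrow>
      (\<exists>P :: (real ^ 'd) set. finite P \<and> card P = n \<and> general_position P \<and>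
         real (num_peelings P)
           \<le> C * (real d + real d * ln (real d)) powr
                 ((2 + (real d - 1) / real_of_int \<lfloor>real d * ln (real d)\<rfloor>) * real n)) \<and>
      real (min_peelings TYPE(real ^ 'd) n)
        \<le> C * (real d + real d * ln (real d)) powr
              ((2 + (real d - 1) / real_of_int \<lfloor>real d * ln (real d)\<rfloor>) * real n))"
proof -
  define k where "k = nat \<lfloor>real d * ln (real d)\<rfloor>"
  define D where "D = real d + real d * ln (real d)"
  define B where "B = D powr (2 + (real d - 1) / real k)"
  have "1 \<le> ln (real d)"
    using exp_le assms(2) by (subst ln_ge_iff) auto
  then have "real d * 1 \<le> real d * ln (real d)" by (intro mult_left_mono) auto
  then have ln3: "3 \<le> real d * ln (real d)" using assms(2) by linarith
  then have "3 \<le> \<lfloor>real d * ln (real d)\<rfloor>" by (simp add: le_floor_iff)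
  then have k: "2 \<le> k" "real k = real_of_int \<lfloor>real d * ln (real d)\<rfloor>" by (auto simp: k_def le_nat_iff)
  have "real k \<le> real d * ln (real d)" unfolding k(2) by simp
  then have "real d + real k \<le> D" by (simp add: D_def)
  then have "(real k + 1) * real (d + k - 1) powr (real (d + k - 1) / real k) < B"
    unfolding B_def using assms(2) k(1) by (intro growth_rate_bound) auto
  then obtain C where C: "0 < C" and ex: "\<And>n. 1 \<le> n \<Longrightarrow> \<exists>P :: (real ^ 'd) set. finite P \<and> card P = n \<and>
      general_position P \<and> real (num_peelings P) \<le> C * B ^ n"
    using few_peelings[where 'd = 'd, OF k(1), of "d + k - 1" B] assms by auto
  have "0 < D" using ln3 by (simp add: D_def)
  then have B_pow: "B ^ n = D powr ((2 + (real d - 1) / real_of_int \<lfloor>real d * ln (real d)\<rfloor>) * real n)" for n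
    unfolding B_def k(2) by (simp add: powr_powr powr_realpow[symmetric])
  show ?thesis
    unfolding D_def[symmetric] B_pow[symmetric]
  proof (intro exI[of _ C] conjI allI impI C)
    fix n :: nat assume "2 \<le> n"
    then show P: "\<exists>P :: (real ^ 'd) set. finite P \<and> card P = n \<and> general_position P \<and>
        real (num_peelings P) \<le> C * B ^ n" by (intro ex) simp
    then show "real (min_peelings TYPE(real ^ 'd) n) \<le> C * B ^ n"
      using min_peelings_le by (metis of_nat_mono order.trans)
  qed
qed

end
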